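(* Let $q\in\mathbb{R}\setminus\{0\}$, $\alpha,\beta\in\mathbb{R}\setminus\{0\}$, $\gamma,\epsilon\in\mathbb{C}\setminus\{0\}$, and let $K,L,M,N$ be nonzero imaginary numbers. Let $\delta$ be the homotopy on the quantum sphere $S^2_q$ with parameters $\alpha,\beta,\gamma,\epsilon$, and $\diamondsuit$ the Hodge operation with parameters $K,L,M,N$, as defined in the context. To have both $$(-1)^n\,\diamondsuit\,\delta\,\xi=\mathrm{d}\,\diamondsuit\,\xi\quad\text{and}\quad \diamondsuit\,\diamondsuit\,\xi=(-1)^{n(2-n)}\,\xi\qquad\text{for all }\xi\in\Omega^nS^2_q\text{ and all }n,$$ we need $$\alpha=K\,L\,q^3,\qquad \beta=-\frac{L}{K}\,q^{-5},\qquad \gamma=q^2,\qquad \epsilon=q^{-4}.$$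
   Context: $\mathbb{C}_q[SL_2]$ is the unital associative $\mathbb{C}$-algebra with generators $a,b,c,d$ and relations $ba=qab$, $ca=qac$, $db=qbd$, $dc=qcd$, $cb=bc$, $da-ad=q(1-q^{-2})bc$, $ad-q^{-1}bc=1$, with conjugate-linear antimultiplicative involution $a^*=d$, $d^*=a$, $c^*=-qb$, $b^*=-q^{-1}c$. It is $\mathbb{Z}$-graded with $a,c$ of grade $+1$ and $b,d$ of grade $-1$; $S^2_q$ is the grade-zero subalgebra. (The differential is written $\mathrm{d}$, distinct from the generator $d$.) Adjoin $e^\pm$ of grade $\pm2$ with $e^\pm f=q^{g}fe^\pm$ for $f\in\mathbb{C}_q[SL_2]$ homogeneous of grade $g$, and $q^2e^+\wedge e^-+e^-\wedge e^+=0$, $e^\pm\wedge e^\pm=0$. $\Omega^0S^2_q=S^2_q$, $\Omega^1S^2_q$ is the set of $e^+f_++e^-f_-$ with $f_\pm$ of grade $\mp2$, $\Omega^2S^2_q$ the set of $e^+\wedge e^-f$ with $f\in S^2_q$ (free over the coefficients). $\mathrm{d}$ is the derivation with $\mathrm{d}a=q\,b\,e^+$, $\mathrm{d}b=a\,e^-$, $\mathrm{d}c=q\,d\,e^+$, $\mathrm{d}d=c\,e^-$, extended to forms by the graded Leibniz rule with $\mathrm{d}e^\pm=0$. Write $\mathrm{d}f=e^+\partial_+f+e^-\partial_-f$. The homotopy: $\delta f=0$ on $S^2_q$, $\delta(e^+f_++e^-f_-)=\alpha q^{-2}\partial_-f_++\beta q^2\partial_+f_-$, $\delta(f\,e^+\wedge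 e^-)=\alpha\gamma q^{-4}e^-\partial_-f-\beta\epsilon q^4e^+\partial_+f$ (from the metric $\alpha(v^+\otimes v^-)+\beta(v^-\otimes v^+)$, $v^\pm$ dual to $e^\pm$, connection $\nabla e^\pm=0$, interior product $v^+\lrcorner(e^+\wedge e^-)=\gamma e^-$, $v^-\lrcorner(e^+\wedge e^-)=-\epsilon e^+$). The Hodge operation $\diamondsuit:\Omega^nS^2_q\to\Omega^{2-n}S^2_q$ is the additive (conjugate linear) map with $\diamondsuit(e^+f)=Ke^-f^*$, $\diamondsuit(e^-f)=Me^+f^*$, $\diamondsuit(e^+\wedge e^-f)=-q^{-2}Lf^*$, $\diamondsuit(f)=Ne^+\wedge e^-f^*$. *)

theory Defs
  imports Complex_Main "HOL-Library.Poly_Mapping" "HOL-Library.Product_Plus"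
    "HOL-Algebra.QuotRing"
begin

section \<open>The algebra of quantum \<open>SL\<^sub>2\<close> by generators and relations\<close>

datatype gen = GA | GB | GC | GD

text \<open>Words form a monoid under concatenation, so that \<^typ>\<open>gen list \<Rightarrow>\<^sub>0 complex\<close> with the
  convolution product of \<^theory>\<open>HOL-Library.Poly_Mapping\<close> is the free unital associative complex
  algebra on the letters \<open>a, b, c, d\<close>.\<close>

instantiation list :: (type) monoid_add
begin
definition zero_list :: "'a list" where "zero_list = []"
definition plus_list :: "'a list \<Rightarrow> 'a list \<Rightarrow> 'a list" where "plus_list = append"
instance by standard (auto simp: zero_list_def plus_list_def)
end

type_synonym free = "gen list \<Rightarrow>\<^sub>0 complex"
type_synonym qfun = "free set" \<comment> \<open>cosets, i.e. elements of the quotient algebra\<close>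

definition const :: "complex \<Rightarrow> free" where "const z = Poly_Mapping.single [] z"
definition letter :: "gen \<Rightarrow> free" where "letter g = Poly_Mapping.single [g] 1"
definition word :: "gen list \<Rightarrow> free" where "word w = Poly_Mapping.single w 1"

definition free_ring :: "free ring" where
  "free_ring = \<lparr>carrier = UNIV, mult = (*), one = 1, zero = 0, add = (+)\<rparr>"

definition relators :: "real \<Rightarrow> free set" where
  "relators q = (let a = letter GA; b = letter GB; c = letter GC; d = letter GD in
     {b * a - const q * a * b,
      c * a - const q * a * c,
      d * b - const q * b * d,
      d * c - const q * c * d,
      c * b - b * c,
      d * a - a * d - const (q * (1 - q powi (-2))) * b * c,
      a * d - const (q powi (-1)) * b * c - 1})"

definition rel_ideal :: "real \<Rightarrow> free set" where
  "rel_ideal q = genideal free_ring (relators q)"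

definition CqSL2 :: "real \<Rightarrow> qfun ring" where
  "CqSL2 q = FactRing free_ring (rel_ideal q)"

definition proj :: "real \<Rightarrow> free \<Rightarrow> qfun" where
  "proj q x = rel_ideal q +>\<^bsub>free_ring\<^esub> x"

definition scal :: "real \<Rightarrow> complex \<Rightarrow> qfun \<Rightarrow> qfun" where
  "scal q z X = proj q (const z) \<otimes>\<^bsub>CqSL2 q\<^esub> X"

text \<open>The map on cosets induced by \<open>f\<close>. It is used only for additive \<open>f\<close> that preserve the ideal,
  when all sets in the union coincide; see \<open>induced_proj\<close> below.\<close>

definition induced :: "real \<Rightarrow> (free \<Rightarrow> free) \<Rightarrow> qfun \<Rightarrow> qfun" where
  "induced q f X = (\<Union>x\<in>X. proj q (f x))"

text \<open>Extension of \<open>\<phi>\<close> from words to the free algebra, semilinear with respect to \<open>\<sigma>\<close>.\<close>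

definition extend :: "(complex \<Rightarrow> complex) \<Rightarrow> (gen list \<Rightarrow> free) \<Rightarrow> free \<Rightarrow> free" where
  "extend \<sigma> \<phi> x = (\<Sum>w\<in>Poly_Mapping.keys x. const (\<sigma> (Poly_Mapping.lookup x w)) * \<phi> w)"

section \<open>Grading and involution\<close>

fun gen_grade :: "gen \<Rightarrow> int" where
  "gen_grade GA = 1" | "gen_grade GB = -1" | "gen_grade GC = 1" | "gen_grade GD = -1"

definition word_grade :: "gen list \<Rightarrow> int" where
  "word_grade w = sum_list (map gen_grade w)"

definition graded :: "real \<Rightarrow> int \<Rightarrow> qfun set" where
  "graded q g = proj q ` {x. \<forall>w\<in>Poly_Mapping.keys x. word_grade w = g}"

definition sphere :: "real \<Rightarrow> qfun set" where
  "sphere q = graded q 0"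

fun gen_star :: "real \<Rightarrow> gen \<Rightarrow> free" where
  "gen_star q GA = letter GD"
| "gen_star q GB = const (- (q powi (-1))) * letter GC"
| "gen_star q GC = const (- q) * letter GB"
| "gen_star q GD = letter GA"

fun word_star :: "real \<Rightarrow> gen list \<Rightarrow> free" where
  "word_star q [] = 1"
| "word_star q (g # w) = word_star q w * gen_star q g"

definition free_star :: "real \<Rightarrow> free \<Rightarrow> free" where
  "free_star q = extend cnj (word_star q)"

definition star :: "real \<Rightarrow> qfun \<Rightarrow> qfun" where
  "star q = induced q (free_star q)"

section \<open>Forms\<close>

text \<open>\<open>Form f0 fp fm f2\<close> stands for \<open>f0 + e\<^sup>+ fp + e\<^sup>- fm + e\<^sup>+ \<and> e\<^sup>- f2\<close>, the coefficients being
  on the right; forms are free over their coefficients.\<close>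

datatype form = Form (coeff0: qfun) (coeffp: qfun) (coeffm: qfun) (coeff2: qfun)

text \<open>\<open>free_twist\<close> and \<open>twist\<close> multiply an element of grade \<open>g\<close> by \<open>q\<^sup>-\<^sup>g\<close>, so that the
  commutation rule reads \<open>f e\<^sup>\<plusminus> = e\<^sup>\<plusminus> (twist f)\<close>.\<close>

definition free_twist :: "real \<Rightarrow> free \<Rightarrow> free" where
  "free_twist q = extend id (\<lambda>w. const (q powi (- word_grade w)) * word w)"

definition twist :: "real \<Rightarrow> qfun \<Rightarrow> qfun" where
  "twist q = induced q (free_twist q)"

definition form_add :: "real \<Rightarrow> form \<Rightarrow> form \<Rightarrow> form" where
  "form_add q \<omega> \<eta> = Form (coeff0 \<omega> \<oplus>\<^bsub>CqSL2 q\<^esub> coeff0 \<eta>) (coeffp \<omega> \<oplus>\<^bsub>CqSL2 q\<^esub> coeffp \<eta>)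
     (coeffm \<omega> \<oplus>\<^bsub>CqSL2 q\<^esub> coeffm \<eta>) (coeff2 \<omega> \<oplus>\<^bsub>CqSL2 q\<^esub> coeff2 \<eta>)"

definition form_scal :: "real \<Rightarrow> complex \<Rightarrow> form \<Rightarrow> form" where
  "form_scal q z \<omega> = Form (scal q z (coeff0 \<omega>)) (scal q z (coeffp \<omega>))
     (scal q z (coeffm \<omega>)) (scal q z (coeff2 \<omega>))"

text \<open>The product of forms determined by \<open>f e\<^sup>\<plusminus> = e\<^sup>\<plusminus> (twist f)\<close>, \<open>e\<^sup>- \<and> e\<^sup>+ = - q\<^sup>2 e\<^sup>+ \<and> e\<^sup>-\<close> and
  \<open>e\<^sup>\<plusminus> \<and> e\<^sup>\<plusminus> = 0\<close>.\<close>

definition wedge :: "real \<Rightarrow> form \<Rightarrow> form \<Rightarrow> form" where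
  "wedge q \<omega> \<eta> = (case (\<omega>, \<eta>) of (Form f0 fp fm f2, Form g0 gp gm g2) \<Rightarrow> Form
     (f0 \<otimes>\<^bsub>CqSL2 q\<^esub> g0)
     (fp \<otimes>\<^bsub>CqSL2 q\<^esub> g0 \<oplus>\<^bsub>CqSL2 q\<^esub> twist q f0 \<otimes>\<^bsub>CqSL2 q\<^esub> gp)
     (fm \<otimes>\<^bsub>CqSL2 q\<^esub> g0 \<oplus>\<^bsub>CqSL2 q\<^esub> twist q f0 \<otimes>\<^bsub>CqSL2 q\<^esub> gm)
     (f2 \<otimes>\<^bsub>CqSL2 q\<^esub> g0 \<oplus>\<^bsub>CqSL2 q\<^esub> twist q (twist q f0) \<otimes>\<^bsub>CqSL2 q\<^esub> g2
        \<oplus>\<^bsub>CqSL2 q\<^esub> twist q fp \<otimes>\<^bsub>CqSL2 q\<^esub> gm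
        \<oplus>\<^bsub>CqSL2 q\<^esub> scal q (- (q\<^sup>2)) (twist q fm \<otimes>\<^bsub>CqSL2 q\<^esub> gp)))"

definition func :: "real \<Rightarrow> qfun \<Rightarrow> form" where
  "func q f = Form f \<zero>\<^bsub>CqSL2 q\<^esub> \<zero>\<^bsub>CqSL2 q\<^esub> \<zero>\<^bsub>CqSL2 q\<^esub>"

definition e_plus :: "real \<Rightarrow> form" where
  "e_plus q = Form \<zero>\<^bsub>CqSL2 q\<^esub> \<one>\<^bsub>CqSL2 q\<^esub> \<zero>\<^bsub>CqSL2 q\<^esub> \<zero>\<^bsub>CqSL2 q\<^esub>"

definition e_minus :: "real \<Rightarrow> form" where
  "e_minus q = Form \<zero>\<^bsub>CqSL2 q\<^esub> \<zero>\<^bsub>CqSL2 q\<^esub> \<one>\<^bsub>CqSL2 q\<^esub> \<zero>\<^bsub>CqSL2 q\<^esub>"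

definition Omega :: "real \<Rightarrow> nat \<Rightarrow> form set" where
  "Omega q n =
     (if n = 0 then {func q f | f. f \<in> sphere q}
      else if n = 1 then {form_add q (wedge q (e_plus q) (func q fp)) (wedge q (e_minus q) (func q fm))
                          | fp fm. fp \<in> graded q (-2) \<and> fm \<in> graded q 2}
      else if n = 2 then {wedge q (wedge q (e_plus q) (e_minus q)) (func q f) | f. f \<in> sphere q}
      else {func q \<zero>\<^bsub>CqSL2 q\<^esub>})"

section \<open>The differential\<close>

text \<open>On the free algebra: a pair \<open>(u, v)\<close> stands for \<open>e\<^sup>+ u + e\<^sup>- v\<close>, with the bimodule structure
  given by the commutation rule.\<close>

fun act_left :: "real \<Rightarrow> free \<Rightarrow> free \<times> free \<Rightarrow> free \<times> free" where
  "act_left q f (u, v) = (free_twist q f * u, free_twist q f * v)"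

fun act_right :: "free \<times> free \<Rightarrow> free \<Rightarrow> free \<times> free" where
  "act_right (u, v) f = (u * f, v * f)"

fun gen_d :: "real \<Rightarrow> gen \<Rightarrow> free \<times> free" where
  "gen_d q GA = act_left q (const q * letter GB) (1, 0)"
| "gen_d q GB = act_left q (letter GA) (0, 1)"
| "gen_d q GC = act_left q (const q * letter GD) (1, 0)"
| "gen_d q GD = act_left q (letter GC) (0, 1)"

fun word_d :: "real \<Rightarrow> gen list \<Rightarrow> free \<times> free" where
  "word_d q [] = 0"
| "word_d q (g # w) = act_right (gen_d q g) (word w) + act_left q (letter g) (word_d q w)"

definition free_dp :: "real \<Rightarrow> free \<Rightarrow> free" where
  "free_dp q = extend id (\<lambda>w. fst (word_d q w))"

definition free_dm :: "real \<Rightarrow> free \<Rightarrow> free" where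
  "free_dm q = extend id (\<lambda>w. snd (word_d q w))"

definition partial_plus :: "real \<Rightarrow> qfun \<Rightarrow> qfun" where
  "partial_plus q = induced q (free_dp q)"

definition partial_minus :: "real \<Rightarrow> qfun \<Rightarrow> qfun" where
  "partial_minus q = induced q (free_dm q)"

definition d_fun :: "real \<Rightarrow> qfun \<Rightarrow> form" where
  "d_fun q f = form_add q (wedge q (e_plus q) (func q (partial_plus q f)))
                          (wedge q (e_minus q) (func q (partial_minus q f)))"

text \<open>The extension to forms by the graded Leibniz rule and \<open>d e\<^sup>\<plusminus> = 0\<close>.\<close>

definition ext_d :: "real \<Rightarrow> form \<Rightarrow> form" where
  "ext_d q \<omega> = (case \<omega> of Form f0 fp fm f2 \<Rightarrow>
     form_add q (d_fun q f0)
    (form_add q (form_scal q (-1) (wedge q (e_plus q) (d_fun q fp)))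
    (form_add q (form_scal q (-1) (wedge q (e_minus q) (d_fun q fm)))
                (wedge q (wedge q (e_plus q) (e_minus q)) (d_fun q f2)))))"

section \<open>The homotopy and the Hodge operation\<close>

text \<open>Both are given on all coefficients at once. For \<open>f\<close> of grade zero \<open>f e\<^sup>+ \<and> e\<^sup>- = e\<^sup>+ \<and> e\<^sup>- f\<close>
  (see \<open>sphere_commutes_with_vol\<close>), so \<open>f2\<close> is the coefficient entering the formula for 2-forms.\<close>

definition homotopy :: "real \<Rightarrow> real \<Rightarrow> real \<Rightarrow> complex \<Rightarrow> complex \<Rightarrow> form \<Rightarrow> form" where
  "homotopy q \<alpha> \<beta> \<gamma> \<epsilon> \<omega> = (case \<omega> of Form f0 fp fm f2 \<Rightarrow> Form
     (scal q (\<alpha> * q powi (-2)) (partial_minus q fp) \<oplus>\<^bsub>CqSL2 q\<^esub> scal q (\<beta> * q\<^sup>2) (partial_plus q fm))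
     (scal q (- (\<beta> * \<epsilon> * q ^ 4)) (partial_plus q f2))
     (scal q (\<alpha> * \<gamma> * q powi (-4)) (partial_minus q f2))
     \<zero>\<^bsub>CqSL2 q\<^esub>)"

definition hodge :: "real \<Rightarrow> complex \<Rightarrow> complex \<Rightarrow> complex \<Rightarrow> complex \<Rightarrow> form \<Rightarrow> form" where
  "hodge q K L M N \<omega> = (case \<omega> of Form f0 fp fm f2 \<Rightarrow> Form
     (scal q (- (q powi (-2)) * L) (star q f2))
     (scal q M (star q fm))
     (scal q K (star q fp))
     (scal q N (star q f0)))"

section \<open>The maps are well defined and have the stated properties\<close>

text \<open>For \<open>q \<noteq> 0\<close> the maps \<^const>\<open>free_star\<close>, \<^const>\<open>free_twist\<close>, \<^const>\<open>free_dp\<close>, \<^const>\<open>free_dm\<close>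
  preserve the ideal, so that the induced maps act on representatives (\<open>induced_on_proj\<close>).
  The remaining results confirm the defining properties of the involution, of the product of
  forms and of the differential.\<close>

lemma ring_free_ring: "ring free_ring"
proof (rule ringI)
  show "abelian_group free_ring"
  proof (rule abelian_groupI)
    fix x assume "x \<in> carrier free_ring"
    show "\<exists>y\<in>carrier free_ring. y \<oplus>\<^bsub>free_ring\<^esub> x = \<zero>\<^bsub>free_ring\<^esub>"
      by (rule bexI[of _ "- x"]) (auto simp: free_ring_def)
  qed (auto simp: free_ring_def)
  show "Group.monoid free_ring"
    by (rule monoidI) (auto simp: free_ring_def mult.assoc)
qed (auto simp: free_ring_def algebra_simps)

lemma ideal_rel_ideal: "ideal (rel_ideal q) free_ring"
  unfolding rel_ideal_def by (rule ring.genideal_ideal[OF ring_free_ring]) (simp add: free_ring_def)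

lemma relators_subset: "relators q \<subseteq> rel_ideal q"
  unfolding rel_ideal_def by (rule ring.genideal_self[OF ring_free_ring]) (simp add: free_ring_def)

lemma rel_zero: "0 \<in> rel_ideal q"
  using additive_subgroup.zero_closed[OF ideal.axioms(1)[OF ideal_rel_ideal]]
  by (simp add: free_ring_def)

lemma rel_add: "x \<in> rel_ideal q \<Longrightarrow> y \<in> rel_ideal q \<Longrightarrow> x + y \<in> rel_ideal q"
  using additive_subgroup.a_closed[OF ideal.axioms(1)[OF ideal_rel_ideal]]
  by (simp add: free_ring_def)

lemma rel_mult_left: "y \<in> rel_ideal q \<Longrightarrow> x * y \<in> rel_ideal q"
  using ideal.I_l_closed[OF ideal_rel_ideal, of y q x] by (simp add: free_ring_def)

lemma rel_mult_right: "y \<in> rel_ideal q \<Longrightarrow> y * x \<in> rel_ideal q"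
  using ideal.I_r_closed[OF ideal_rel_ideal, of y q x] by (simp add: free_ring_def)

lemma rel_uminus: "x \<in> rel_ideal q \<Longrightarrow> - x \<in> rel_ideal q"
  using rel_mult_left[of x q "-1"] by simp

lemma rel_diff: "x \<in> rel_ideal q \<Longrightarrow> y \<in> rel_ideal q \<Longrightarrow> x - y \<in> rel_ideal q"
  using rel_add[of x q "-y"] rel_uminus by simp

lemma proj_eq: "proj q x = {i + x | i. i \<in> rel_ideal q}"
  by (auto simp: proj_def free_ring_def a_r_coset_def')

lemma proj_eq_iff: "proj q x = proj q y \<longleftrightarrow> x - y \<in> rel_ideal q"
proof
  assume "proj q x = proj q y"
  moreover have "x \<in> proj q x" unfolding proj_eq using rel_zero[of q] by force
  ultimately show "x - y \<in> rel_ideal q" by (auto simp: proj_eq)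
next
  assume h: "x - y \<in> rel_ideal q"
  have "\<exists>j. i + x = j + y \<and> j \<in> rel_ideal q" if "i \<in> rel_ideal q" for i
    by (rule exI[of _ "i + (x - y)"]) (use rel_add[OF that h] in \<open>auto simp: algebra_simps\<close>)
  moreover have "\<exists>j. i + y = j + x \<and> j \<in> rel_ideal q" if "i \<in> rel_ideal q" for i
    by (rule exI[of _ "i - (x - y)"]) (use rel_diff[OF that h] in \<open>auto simp: algebra_simps\<close>)
  ultimately show "proj q x = proj q y" unfolding proj_eq by blast
qed

lemma mem_projD: "y \<in> proj q x \<Longrightarrow> y - x \<in> rel_ideal q"
  by (auto simp: proj_eq)

lemma proj_self: "x \<in> proj q x"
  unfolding proj_eq using rel_zero[of q] by force

lemma proj_mult: "proj q x \<otimes>\<^bsub>CqSL2 q\<^esub> proj q y = proj q (x * y)"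
  using ideal.rcoset_mult_add[OF ideal_rel_ideal, of x y q]
  by (simp add: CqSL2_def FactRing_def proj_def) (simp add: free_ring_def)

lemma proj_add: "proj q x \<oplus>\<^bsub>CqSL2 q\<^esub> proj q y = proj q (x + y)"
  using abelian_subgroup.a_rcos_sum[OF abelian_subgroupI3, OF ideal.axioms(1)[OF ideal_rel_ideal] ring.is_abelian_group[OF ring_free_ring], of x y q]
  by (simp add: CqSL2_def FactRing_def proj_def) (simp add: free_ring_def)

lemma proj_one: "\<one>\<^bsub>CqSL2 q\<^esub> = proj q 1"
  by (simp add: CqSL2_def FactRing_def proj_def) (simp add: free_ring_def)

lemma proj_zero: "\<zero>\<^bsub>CqSL2 q\<^esub> = proj q 0"
  by (auto simp: CqSL2_def FactRing_def proj_eq)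

lemma carrier_CqSL2: "carrier (CqSL2 q) = range (proj q)"
  by (auto simp: CqSL2_def FactRing_def A_RCOSETS_def' proj_def free_ring_def)

lemma ring_CqSL2: "ring (CqSL2 q)"
  unfolding CqSL2_def by (rule ideal.quotient_is_ring[OF ideal_rel_ideal])

lemma induced_proj:
  assumes "\<And>x y. f (x - y) = f x - f y" "f ` rel_ideal q \<subseteq> rel_ideal q"
  shows "induced q f (proj q x) = proj q (f x)"
proof -
  have "proj q (f y) = proj q (f x)" if "y \<in> proj q x" for y
    using mem_projD[OF that] assms by (auto simp: proj_eq_iff assms(1)[symmetric])
  then show ?thesis unfolding induced_def using proj_self[of x q] by blast
qed

lemma rel_ideal_induct [consumes 1, case_names relator zero add left right]:
  assumes "x \<in> rel_ideal q"
    and "\<And>x. x \<in> relators q \<Longrightarrow> P x" and "P 0"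
    and "\<And>x y. x \<in> rel_ideal q \<Longrightarrow> y \<in> rel_ideal q \<Longrightarrow> P x \<Longrightarrow> P y \<Longrightarrow> P (x + y)"
    and "\<And>x y. y \<in> rel_ideal q \<Longrightarrow> P y \<Longrightarrow> P (x * y)"
    and "\<And>x y. y \<in> rel_ideal q \<Longrightarrow> P y \<Longrightarrow> P (y * x)"
  shows "P x"
proof -
  let ?J = "{x \<in> rel_ideal q. P x}"
  have "ideal ?J free_ring"
  proof (rule idealI)
    show "ring free_ring" by (rule ring_free_ring)
    show "subgroup ?J (add_monoid free_ring)"
    proof (rule group.subgroupI)
      show "Group.group (add_monoid free_ring)"
        by (rule abelian_group.a_group[OF ring.is_abelian_group[OF ring_free_ring]])
      show "?J \<noteq> {}" using assms(3) rel_zero by blast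
      fix a assume a: "a \<in> ?J"
      have "inv\<^bsub>add_monoid free_ring\<^esub> a = - a"
        using group.inv_equality[OF abelian_group.a_group[OF ring.is_abelian_group[OF ring_free_ring]], of "-a" a]
        by (simp add: free_ring_def)
      moreover have "- a \<in> ?J" using a assms(5)[of a "-1"] rel_uminus by auto
      ultimately show "inv\<^bsub>add_monoid free_ring\<^esub> a \<in> ?J" by simp
    qed (use assms(4) rel_add in \<open>auto simp: free_ring_def\<close>)
  qed (use assms(5,6) rel_mult_left rel_mult_right in \<open>auto simp: free_ring_def\<close>)
  then have "rel_ideal q \<subseteq> ?J"
    unfolding rel_ideal_def
    by (rule ring.genideal_minimal[OF ring_free_ring])
       (use assms(2) relators_subset rel_ideal_def in auto)
  then show ?thesis using assms(1) by blast
qed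

lemma free_induct [case_names zero single add]:
  assumes "P 0" "\<And>w z. P (Poly_Mapping.single w z)" "\<And>x y. P x \<Longrightarrow> P y \<Longrightarrow> P (x + y)"
  shows "P (x :: free)"
proof -
  have "x = (\<Sum>w\<in>Poly_Mapping.keys x. Poly_Mapping.single w (Poly_Mapping.lookup x w))"
    by (rule poly_mapping_eqI)
       (simp add: lookup_sum lookup_single when_def in_keys_iff)
  moreover have "P (\<Sum>w\<in>A. Poly_Mapping.single w (Poly_Mapping.lookup x w))" if "finite A" for A
    using that by (induction A rule: finite_induct) (auto intro: assms)
  ultimately show ?thesis by (metis finite_keys)
qed

lemma const_simps [simp]:
  "const 0 = 0" "const 1 = 1" "const (x + y) = const x + const y" "const (x * y) = const x * const y"
  "const (- x) = - const x"
  by (simp_all add: const_def single_add mult_single zero_list_def[symmetric] single_uminus)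

lemma const_commute: "x * const z = const z * x"
  by (induction x rule: free_induct)
     (simp_all add: const_def mult_single zero_list_def[symmetric] algebra_simps)

lemma extend_alt:
  assumes "finite A" "Poly_Mapping.keys x \<subseteq> A" "\<sigma> 0 = 0"
  shows "extend \<sigma> \<phi> x = (\<Sum>w\<in>A. const (\<sigma> (Poly_Mapping.lookup x w)) * \<phi> w)"
  unfolding extend_def  by (rule sum.mono_neutral_left) (use assms in \<open>auto simp: in_keys_iff\<close>)

lemma extend_add:
  assumes "\<sigma> 0 = 0" "\<And>x y. \<sigma> (x + y) = \<sigma> x + \<sigma> y"
  shows "extend \<sigma> \<phi> (x + y) = extend \<sigma> \<phi> x + extend \<sigma> \<phi> y"
proof -
  let ?A = "Poly_Mapping.keys x \<union> Poly_Mapping.keys y"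
  show ?thesis
    using Poly_Mapping.keys_add[of x y] assms
    by (simp add: extend_alt[of ?A] lookup_add distrib_right sum.distrib)
qed

lemma extend_zero [simp]: "extend \<sigma> \<phi> 0 = 0" by (simp add: extend_def)

lemma extend_single:
  assumes "\<sigma> 0 = 0" shows "extend \<sigma> \<phi> (Poly_Mapping.single w z) = const (\<sigma> z) * \<phi> w"
  using assms by (simp add: extend_alt[of "{w}"])

lemmas free_defs = free_star_def free_dp_def free_dm_def free_twist_def

lemma free_add [simp]:
  "free_star q (x + y) = free_star q x + free_star q y"
  "free_dp q (x + y) = free_dp q x + free_dp q y"
  "free_dm q (x + y) = free_dm q x + free_dm q y"
  "free_twist q (x + y) = free_twist q x + free_twist q y"
  by (simp_all add: free_defs extend_add)

lemma free_zero [simp]: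
  "free_star q 0 = 0" "free_dp q 0 = 0" "free_dm q 0 = 0" "free_twist q 0 = 0"
  by (simp_all add: free_defs)

lemma free_diff [simp]:
  "free_star q (x - y) = free_star q x - free_star q y"
  "free_dp q (x - y) = free_dp q x - free_dp q y"
  "free_dm q (x - y) = free_dm q x - free_dm q y"
  "free_twist q (x - y) = free_twist q x - free_twist q y"
  using free_add[of q "x - y" y] by (simp_all add: algebra_simps)

lemma free_single:
  "free_star q (Poly_Mapping.single w z) = const (cnj z) * word_star q w"
  "free_dp q (Poly_Mapping.single w z) = const z * fst (word_d q w)"
  "free_dm q (Poly_Mapping.single w z) = const z * snd (word_d q w)"
  "free_twist q (Poly_Mapping.single w z) = const z * const (q powi (- word_grade w)) * word w"
  by (simp_all add: free_defs extend_single mult.assoc)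

lemma word_grade_append [simp]: "word_grade (u @ v) = word_grade u + word_grade v"
  by (simp add: word_grade_def)

lemma word_append: "word (u @ v) = word u * word v"
  by (simp add: word_def mult_single plus_list_def)

lemma const_const_left: "const u * (const v * x) = const (u * v) * x" by (simp add: mult.assoc)

lemma const_left_commute: "x * (const z * y) = const z * (x * y)"
  by (metis const_commute mult.assoc)

lemmas cmove = const_commute[of "word _"] const_left_commute[of "word _"]
  const_commute[of "word_star _ _"] const_left_commute[of "word_star _ _"]
  const_commute[of "fst (word_d _ _)"] const_left_commute[of "fst (word_d _ _)"]
  const_commute[of "snd (word_d _ _)"] const_left_commute[of "snd (word_d _ _)"]

lemma const_const: "const x * const y = const (x * y)" by simp
lemmas scalars = cmove const_const const_const_left mult.assoc

lemma word_star_append: "word_star q (u @ v) = word_star q v * word_star q u"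
  by (induction u) (simp_all add: mult.assoc)

lemma free_star_mult: "free_star q (x * y) = free_star q y * free_star q x"
proof (induction x rule: free_induct)
  case (single u s)
  show ?case
    by (induction y rule: free_induct)
       (simp_all add: mult_single free_single plus_list_def word_star_append distrib_left distrib_right scalars mult.commute[of s] del: const_simps(4))
qed (simp_all add: algebra_simps)

lemma free_twist_mult:
  assumes "q \<noteq> 0" shows "free_twist q (x * y) = free_twist q x * free_twist q y"
proof (induction x rule: free_induct)
  case (single u s)
  show ?case
    by (induction y rule: free_induct)
       (simp_all add: mult_single free_single plus_list_def word_append power_int_add power_int_diff
          distrib_left distrib_right scalars assms mult_ac del: const_simps(4), simp_all add: power_int_minus field_simps assms)
qed (simp_all add: algebra_simps)

lemma free_twist_word: "free_twist q (word w) = const (q powi (- word_grade w)) * word w"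
  by (simp add: word_def free_single)

lemma fst_act [simp]: "fst (act_left q f p) = free_twist q f * fst p"
    "snd (act_left q f p) = free_twist q f * snd p"
    "fst (act_right p f) = fst p * f" "snd (act_right p f) = snd p * f"
  by (cases p; simp)+

lemma word_Nil: "word [] = 1" by (simp add: word_def zero_list_def[symmetric])
lemma word_Cons: "word (g # w) = letter g * word w"
  using word_append[of "[g]" w] by (simp add: letter_def word_def)

lemma word_d_append:
  assumes "q \<noteq> 0"
  shows "fst (word_d q (u @ v)) = fst (word_d q u) * word v + free_twist q (word u) * fst (word_d q v)"
   and "snd (word_d q (u @ v)) = snd (word_d q u) * word v + free_twist q (word u) * snd (word_d q v)"
  by (induction u) (simp_all add: word_Nil word_Cons free_twist_mult[OF assms] word_append algebra_simps
       free_twist_word[of q "[]", unfolded word_Nil] word_grade_def)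

lemma free_dp_mult:
  assumes "q \<noteq> 0"
  shows "free_dp q (x * y) = free_dp q x * y + free_twist q x * free_dp q y"
    and "free_dm q (x * y) = free_dm q x * y + free_twist q x * free_dm q y"
proof -
  have "free_dp q (x * y) = free_dp q x * y + free_twist q x * free_dp q y \<and>
     free_dm q (x * y) = free_dm q x * y + free_twist q x * free_dm q y"
  proof (induction x rule: free_induct)
    case (single u s)
    have s: "Poly_Mapping.single w z = const z * word w" for w z
      by (simp add: const_def word_def mult_single plus_list_def)
    show ?case
    proof (induction y rule: free_induct)
      case (single v t)
      show ?case
        by (simp add: mult_single free_single plus_list_def word_d_append[OF assms])
           (simp add: s[of v t] free_twist_word distrib_left distrib_right scalars mult_ac del: const_simps(4))
    qed (simp_all add: algebra_simps)
  qed (simp_all add: algebra_simps)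
  then show "free_dp q (x * y) = free_dp q x * y + free_twist q x * free_dp q y"
    and "free_dm q (x * y) = free_dm q x * y + free_twist q x * free_dm q y" by auto
qed

lemma free_const [simp]:
  "free_star q (const z) = const (cnj z)" "free_dp q (const z) = 0" "free_dm q (const z) = 0"
  "free_twist q (const z) = const z"
  by (simp_all add: const_def free_single)
     (simp_all add: const_def word_def mult_single plus_list_def word_grade_def)

lemma free_letter [simp]:
  "free_star q (letter g) = gen_star q g"
  "free_dp q (letter g) = fst (gen_d q g)" "free_dm q (letter g) = snd (gen_d q g)"
  "free_twist q (letter g) = const (q powi (- gen_grade g)) * letter g"
  by (simp_all add: letter_def free_single word_Nil)
     (simp_all add: letter_def word_def mult_single plus_list_def word_grade_def)

lemma free_one [simp]: "free_star q 1 = 1" "free_dp q 1 = 0" "free_dm q 1 = 0" "free_twist q 1 = 1"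
  using free_const[of q 1] by (simp_all del: free_const)

definition kron :: "gen list \<Rightarrow> gen list \<Rightarrow> complex" where "kron w k = (1 when w = k)"

lemma lookup_single_kron: "Poly_Mapping.lookup (Poly_Mapping.single w z) k = z * kron w k"
  by (simp add: lookup_single kron_def when_def)

lemma one_single: "(1::free) = Poly_Mapping.single [] 1"
  by (simp add: zero_list_def[symmetric])

lemma free_preserves_relators:
  assumes "q \<noteq> 0" "x \<in> relators q"
  shows "free_star q x \<in> rel_ideal q" and "free_twist q x \<in> rel_ideal q"
    and "free_dp q x \<in> rel_ideal q" and "free_dm q x \<in> rel_ideal q"
proof -
  define a b c d where abcd: "a = letter GA" "b = letter GB" "c = letter GC" "d = letter GD"
  define R1 where "R1 = b * a - const q * a * b"
  define R2 where "R2 = c * a - const q * a * c"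
  define R3 where "R3 = d * b - const q * b * d"
  define R4 where "R4 = d * c - const q * c * d"
  define R5 where "R5 = c * b - b * c"
  define R6 where "R6 = d * a - a * d - const (q * (1 - q powi (-2))) * b * c"
  define R7 where "R7 = a * d - const (q powi (-1)) * b * c - 1"
  note R = R1_def R2_def R3_def R4_def R5_def R6_def R7_def
  have rel: "relators q = {R1, R2, R3, R4, R5, R6, R7}"
    by (simp add: relators_def Let_def R abcd)
  have I: "const z * r \<in> rel_ideal q" "r \<in> rel_ideal q" if "r \<in> {R1, R2, R3, R4, R5, R6, R7}" for r z
    using that relators_subset[of q] rel rel_mult_left by blast+
  note ev = free_star_mult free_twist_mult[OF assms(1)] free_dp_mult[OF assms(1)] R abcd
  note si = letter_def const_def mult_single plus_list_def one_single
     power_int_minus power_int_numeral zero_list_def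
  note lo = lookup_add lookup_minus lookup_uminus lookup_single_kron
  have "free_star q R1 = const (- (q powi (-1))) * R4" "free_star q R2 = const (- q) * R3"
       "free_star q R3 = const (- (q powi (-1))) * R2" "free_star q R4 = const (- q) * R1"
       "free_star q R5 = R5" "free_star q R6 = R6" "free_star q R7 = R7"
    using assms(1) by - ((simp_all add: ev del: const_simps)?, (simp_all add: si algebra_simps del: const_simps)?, ((rule poly_mapping_eqI, simp add: lo, (simp add: field_simps power2_eq_square power3_eq_cube)?)+)?)
  then show "free_star q x \<in> rel_ideal q" using assms(2) unfolding rel by (auto intro!: rel_uminus rel_mult_left intro: I)
  have "free_twist q R1 = R1" "free_twist q R2 = const (q powi (-2)) * R2"
       "free_twist q R3 = const (q powi 2) * R3" "free_twist q R4 = R4"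
       "free_twist q R5 = R5" "free_twist q R6 = R6" "free_twist q R7 = R7"
    using assms(1) by - ((simp_all add: ev del: const_simps)?, (simp_all add: si algebra_simps del: const_simps)?, ((rule poly_mapping_eqI, simp add: lo, (simp add: field_simps power2_eq_square power3_eq_cube)?)+)?)
  then show "free_twist q x \<in> rel_ideal q" using assms(2) unfolding rel by (auto intro!: rel_uminus rel_mult_left intro: I)
  have "free_dp q R1 = 0" "free_dp q R2 = const (q^2) * R6 + const q * R5"
       "free_dp q R3 = 0" "free_dp q R4 = 0"
       "free_dp q R5 = const (q^2) * R3" "free_dp q R6 = const (q^3) * R3" "free_dp q R7 = 0"
    using assms(1) by - ((simp_all add: ev del: const_simps)?, (simp_all add: si algebra_simps del: const_simps)?, ((rule poly_mapping_eqI, simp add: lo, (simp add: field_simps power2_eq_square power3_eq_cube)?)+)?)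
  then show "free_dp q x \<in> rel_ideal q" using assms(2) unfolding rel by (auto intro!: rel_add rel_zero rel_uminus rel_mult_left intro: I)
  have "free_dm q R1 = 0" "free_dm q R2 = 0" "free_dm q R3 = R6 + const (q powi (-1)) * R5"
       "free_dm q R4 = 0"
       "free_dm q R5 = const (q powi (-2)) * R2" "free_dm q R6 = const (q powi (-1)) * R2" "free_dm q R7 = 0"
    using assms(1) by - ((simp_all add: ev del: const_simps)?, (simp_all add: si algebra_simps del: const_simps)?, ((rule poly_mapping_eqI, simp add: lo, (simp add: field_simps power2_eq_square power3_eq_cube)?)+)?)
  then show "free_dm q x \<in> rel_ideal q" using assms(2) unfolding rel by (auto intro!: rel_add rel_zero rel_uminus rel_mult_left intro: I)
qed

lemma free_preserves:
  assumes "q \<noteq> 0" "x \<in> rel_ideal q"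
  shows "free_star q x \<in> rel_ideal q" "free_twist q x \<in> rel_ideal q"
    "free_dp q x \<in> rel_ideal q" "free_dm q x \<in> rel_ideal q"
proof -
  have "free_star q x \<in> rel_ideal q \<and> free_twist q x \<in> rel_ideal q
    \<and> free_dp q x \<in> rel_ideal q \<and> free_dm q x \<in> rel_ideal q"
    using assms(2)
  proof (induction rule: rel_ideal_induct)
    case (relator x)
    then show ?case using free_preserves_relators[OF assms(1)] by blast
  qed (auto simp: rel_zero free_star_mult free_twist_mult[OF assms(1)] free_dp_mult[OF assms(1)]
         intro!: rel_add intro: rel_mult_left rel_mult_right)
  then show "free_star q x \<in> rel_ideal q" "free_twist q x \<in> rel_ideal q"
    "free_dp q x \<in> rel_ideal q" "free_dm q x \<in> rel_ideal q" by blast+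
qed

lemma induced_on_proj:
  assumes "q \<noteq> 0"
  shows star_proj: "star q (proj q x) = proj q (free_star q x)"
    and twist_proj: "twist q (proj q x) = proj q (free_twist q x)"
    and partial_plus_proj: "partial_plus q (proj q x) = proj q (free_dp q x)"
    and partial_minus_proj: "partial_minus q (proj q x) = proj q (free_dm q x)"
  unfolding star_def twist_def partial_plus_def partial_minus_def
  using free_preserves[OF assms] by (auto intro!: induced_proj)

lemma scal_proj: "scal q z (proj q x) = proj q (const z * x)"
  by (simp add: scal_def proj_mult)

lemmas proj_simps = proj_mult proj_add proj_zero proj_one scal_proj

lemma CqSL2_cases: assumes "X \<in> carrier (CqSL2 q)" obtains x where "X = proj q x"
  using assms by (auto simp: carrier_CqSL2)

lemma CqSL2_relations:
  fixes q :: real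
  defines "a \<equiv> proj q (letter GA)" and "b \<equiv> proj q (letter GB)"
    and "c \<equiv> proj q (letter GC)" and "d \<equiv> proj q (letter GD)"
  shows "b \<otimes>\<^bsub>CqSL2 q\<^esub> a = scal q q (a \<otimes>\<^bsub>CqSL2 q\<^esub> b)"
    and "c \<otimes>\<^bsub>CqSL2 q\<^esub> a = scal q q (a \<otimes>\<^bsub>CqSL2 q\<^esub> c)"
    and "d \<otimes>\<^bsub>CqSL2 q\<^esub> b = scal q q (b \<otimes>\<^bsub>CqSL2 q\<^esub> d)"
    and "d \<otimes>\<^bsub>CqSL2 q\<^esub> c = scal q q (c \<otimes>\<^bsub>CqSL2 q\<^esub> d)"
    and "c \<otimes>\<^bsub>CqSL2 q\<^esub> b = b \<otimes>\<^bsub>CqSL2 q\<^esub> c"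
    and "d \<otimes>\<^bsub>CqSL2 q\<^esub> a \<ominus>\<^bsub>CqSL2 q\<^esub> a \<otimes>\<^bsub>CqSL2 q\<^esub> d = scal q (q * (1 - q powi (-2))) (b \<otimes>\<^bsub>CqSL2 q\<^esub> c)"
    and "a \<otimes>\<^bsub>CqSL2 q\<^esub> d \<ominus>\<^bsub>CqSL2 q\<^esub> scal q (q powi (-1)) (b \<otimes>\<^bsub>CqSL2 q\<^esub> c) = \<one>\<^bsub>CqSL2 q\<^esub>"
proof -
  have minus: "proj q x \<ominus>\<^bsub>CqSL2 q\<^esub> proj q y = proj q (x - y)" for x y
  proof -
    interpret R: ring "CqSL2 q" by (rule ring_CqSL2)
    have "proj q z \<in> carrier (CqSL2 q)" for z by (simp add: carrier_CqSL2)
    then have "\<ominus>\<^bsub>CqSL2 q\<^esub> proj q y = proj q (- y)"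
      by (intro R.minus_equality) (simp_all add: proj_simps)
    then show ?thesis by (simp add: a_minus_def proj_simps)
  qed
  have r: "x - y \<in> relators q \<Longrightarrow> proj q x = proj q y" for x y
    using relators_subset by (auto simp: proj_eq_iff)
  show "b \<otimes>\<^bsub>CqSL2 q\<^esub> a = scal q q (a \<otimes>\<^bsub>CqSL2 q\<^esub> b)"
    "c \<otimes>\<^bsub>CqSL2 q\<^esub> a = scal q q (a \<otimes>\<^bsub>CqSL2 q\<^esub> c)"
    "d \<otimes>\<^bsub>CqSL2 q\<^esub> b = scal q q (b \<otimes>\<^bsub>CqSL2 q\<^esub> d)"
    "d \<otimes>\<^bsub>CqSL2 q\<^esub> c = scal q q (c \<otimes>\<^bsub>CqSL2 q\<^esub> d)"
    "c \<otimes>\<^bsub>CqSL2 q\<^esub> b = b \<otimes>\<^bsub>CqSL2 q\<^esub> c"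
    "d \<otimes>\<^bsub>CqSL2 q\<^esub> a \<ominus>\<^bsub>CqSL2 q\<^esub> a \<otimes>\<^bsub>CqSL2 q\<^esub> d = scal q (q * (1 - q powi (-2))) (b \<otimes>\<^bsub>CqSL2 q\<^esub> c)"
    "a \<otimes>\<^bsub>CqSL2 q\<^esub> d \<ominus>\<^bsub>CqSL2 q\<^esub> scal q (q powi (-1)) (b \<otimes>\<^bsub>CqSL2 q\<^esub> c) = \<one>\<^bsub>CqSL2 q\<^esub>"
    unfolding a_def b_def c_def d_def proj_simps minus
    by (rule r, simp add: relators_def Let_def mult.assoc del: const_simps)+
qed

lemma star_properties:
  assumes "q \<noteq> 0" "X \<in> carrier (CqSL2 q)" "Y \<in> carrier (CqSL2 q)"
  shows "star q (X \<oplus>\<^bsub>CqSL2 q\<^esub> Y) = star q X \<oplus>\<^bsub>CqSL2 q\<^esub> star q Y"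
    and "star q (scal q z X) = scal q (cnj z) (star q X)"
    and "star q (X \<otimes>\<^bsub>CqSL2 q\<^esub> Y) = star q Y \<otimes>\<^bsub>CqSL2 q\<^esub> star q X"
    and "star q (star q X) = X"
proof -
  have ss: "free_star q (free_star q x) = x" for x
  proof (induction x rule: free_induct)
    case (single w z)
    have uminus: "free_star q (- y) = - free_star q y" for y
      using free_diff(1)[of q 0 y] by simp
    have "free_star q (gen_star q g) = letter g" for g
      using assms(1) by (cases g)
        (simp_all add: free_star_mult mult.assoc const_commute[of "letter _"] const_const_left const_const power_int_minus uminus del: const_simps(4,5))
    then have "free_star q (word_star q w) = word w"
      by (induction w) (simp_all add: free_star_mult word_Nil word_Cons)
    then show ?case
      by (simp add: free_single free_star_mult const_commute[of "word w"])
         (simp add: word_def const_def mult_single plus_list_def)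
  qed simp_all
  obtain x y where "X = proj q x" "Y = proj q y" using assms(2,3) CqSL2_cases by metis
  then show "star q (X \<oplus>\<^bsub>CqSL2 q\<^esub> Y) = star q X \<oplus>\<^bsub>CqSL2 q\<^esub> star q Y"
    "star q (scal q z X) = scal q (cnj z) (star q X)"
    "star q (X \<otimes>\<^bsub>CqSL2 q\<^esub> Y) = star q Y \<otimes>\<^bsub>CqSL2 q\<^esub> star q X"
    "star q (star q X) = X"
    by (simp_all add: proj_simps star_proj[OF assms(1)] free_star_mult ss const_commute[of "free_star q x"])
qed

lemma star_generators:
  assumes "q \<noteq> 0"
  shows "star q (proj q (letter GA)) = proj q (letter GD)"
    and "star q (proj q (letter GD)) = proj q (letter GA)"
    and "star q (proj q (letter GC)) = scal q (- q) (proj q (letter GB))"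
    and "star q (proj q (letter GB)) = scal q (- (q powi (-1))) (proj q (letter GC))"
  using assms by (simp_all add: star_proj scal_proj)

lemma wedge_relations:
  assumes "q \<noteq> 0"
  shows "wedge q (e_plus q) (e_plus q) = func q \<zero>\<^bsub>CqSL2 q\<^esub>"
    and "wedge q (e_minus q) (e_minus q) = func q \<zero>\<^bsub>CqSL2 q\<^esub>"
    and "form_add q (form_scal q (q\<^sup>2) (wedge q (e_plus q) (e_minus q))) (wedge q (e_minus q) (e_plus q))
      = func q \<zero>\<^bsub>CqSL2 q\<^esub>"
  by (simp_all add: wedge_def e_plus_def e_minus_def func_def form_add_def form_scal_def proj_simps twist_proj[OF assms])

lemma twist_graded:
  assumes "q \<noteq> 0" "f \<in> graded q g" shows "twist q f = scal q (q powi (- g)) f"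
proof -
  obtain x where x: "\<forall>w\<in>Poly_Mapping.keys x. word_grade w = g" "f = proj q x"
    using assms(2) by (auto simp: graded_def)
  have "free_twist q x = const (q powi (- g)) * (\<Sum>w\<in>Poly_Mapping.keys x. const (Poly_Mapping.lookup x w) * word w)"
    unfolding free_twist_def extend_def sum_distrib_left
    by (rule sum.cong) (use x in \<open>simp_all add: const_const_left mult.commute del: const_simps(4)\<close>)
  also have "(\<Sum>w\<in>Poly_Mapping.keys x. const (Poly_Mapping.lookup x w) * word w) = x"
    by (rule poly_mapping_eqI)
       (simp add: const_def word_def mult_single plus_list_def lookup_sum lookup_single when_def in_keys_iff)
  finally show ?thesis using x assms(1) by (simp add: twist_proj scal_proj)
qed

lemma e_commute:
  assumes "q \<noteq> 0" "f \<in> graded q g"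
  shows "wedge q (e_plus q) (func q f) = form_scal q (q powi g) (wedge q (func q f) (e_plus q))"
    and "wedge q (e_minus q) (func q f) = form_scal q (q powi g) (wedge q (func q f) (e_minus q))"
proof -
  obtain x where x: "f = proj q x" using assms(2) by (auto simp: graded_def)
  have "const (q powi g) * (const (q powi (-g)) * x) = x"
    using assms(1) by (simp add: const_const_left power_int_minus del: const_simps(4)) 
  then show "wedge q (e_plus q) (func q f) = form_scal q (q powi g) (wedge q (func q f) (e_plus q))"
    "wedge q (e_minus q) (func q f) = form_scal q (q powi g) (wedge q (func q f) (e_minus q))"
    by (simp_all add: wedge_def e_plus_def e_minus_def func_def form_scal_def twist_graded[OF assms])
       (simp_all add: x proj_simps twist_proj[OF assms(1)])
qed

lemma sphere_commutes_with_vol: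
  assumes "q \<noteq> 0" "f \<in> sphere q"
  shows "wedge q (func q f) (wedge q (e_plus q) (e_minus q)) = wedge q (wedge q (e_plus q) (e_minus q)) (func q f)"
proof -
  obtain x where x: "f = proj q x" using assms(2) by (auto simp: sphere_def graded_def)
  have "twist q f = f"
    using twist_graded[OF assms(1) assms(2)[unfolded sphere_def]] by (simp add: x scal_proj)
  then show ?thesis
    by (simp add: wedge_def e_plus_def e_minus_def func_def)
       (simp add: x proj_simps twist_proj[OF assms(1)])
qed

lemma d_fun_properties:
  assumes "q \<noteq> 0" "X \<in> carrier (CqSL2 q)" "Y \<in> carrier (CqSL2 q)"
  shows "d_fun q (X \<oplus>\<^bsub>CqSL2 q\<^esub> Y) = form_add q (d_fun q X) (d_fun q Y)"
    and "d_fun q (scal q z X) = form_scal q z (d_fun q X)"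
    and "d_fun q (X \<otimes>\<^bsub>CqSL2 q\<^esub> Y)
      = form_add q (wedge q (d_fun q X) (func q Y)) (wedge q (func q X) (d_fun q Y))"
proof -
  obtain x y where xy: "X = proj q x" "Y = proj q y" using assms(2,3) CqSL2_cases by metis
  show "d_fun q (X \<oplus>\<^bsub>CqSL2 q\<^esub> Y) = form_add q (d_fun q X) (d_fun q Y)"
    "d_fun q (scal q z X) = form_scal q z (d_fun q X)"
    "d_fun q (X \<otimes>\<^bsub>CqSL2 q\<^esub> Y)
      = form_add q (wedge q (d_fun q X) (func q Y)) (wedge q (func q X) (d_fun q Y))"
    unfolding xy d_fun_def
    by (simp_all add: wedge_def e_plus_def e_minus_def func_def form_add_def form_scal_def proj_simps
          twist_proj[OF assms(1)] partial_plus_proj[OF assms(1)] partial_minus_proj[OF assms(1)]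
          free_dp_mult[OF assms(1)])
qed

lemma d_fun_generators:
  assumes "q \<noteq> 0"
  shows "d_fun q (proj q (letter GA)) = wedge q (func q (scal q q (proj q (letter GB)))) (e_plus q)"
    and "d_fun q (proj q (letter GB)) = wedge q (func q (proj q (letter GA))) (e_minus q)"
    and "d_fun q (proj q (letter GC)) = wedge q (func q (scal q q (proj q (letter GD)))) (e_plus q)"
    and "d_fun q (proj q (letter GD)) = wedge q (func q (proj q (letter GC))) (e_minus q)"
  by (simp_all add: d_fun_def wedge_def e_plus_def e_minus_def func_def form_add_def proj_simps
        twist_proj[OF assms] partial_plus_proj[OF assms] partial_minus_proj[OF assms] free_twist_mult[OF assms])
lemma free_scalar:
  "free_star q (const z * x) = const (cnj z) * free_star q x"
  "q \<noteq> 0 \<Longrightarrow> free_twist q (const z * x) = const z * free_twist q x"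
  by (simp_all add: free_star_mult free_twist_mult const_commute[of "free_star q x"])

lemma wedge_assoc:
  assumes "q \<noteq> 0"
    and "\<And>\<omega>. \<omega> \<in> {\<omega>1, \<omega>2, \<omega>3} \<Longrightarrow> {coeff0 \<omega>, coeffp \<omega>, coeffm \<omega>, coeff2 \<omega>} \<subseteq> carrier (CqSL2 q)"
  shows "wedge q (wedge q \<omega>1 \<omega>2) \<omega>3 = wedge q \<omega>1 (wedge q \<omega>2 \<omega>3)"
proof -
  have "\<exists>a b c e. \<omega> = Form (proj q a) (proj q b) (proj q c) (proj q e)" if "\<omega> \<in> {\<omega>1, \<omega>2, \<omega>3}" for \<omega>
    using assms(2)[OF that] by (cases \<omega>) (auto simp: carrier_CqSL2)
  then obtain a1 b1 c1 e1 a2 b2 c2 e2 a3 b3 c3 e3 where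
    w: "\<omega>1 = Form (proj q a1) (proj q b1) (proj q c1) (proj q e1)"
       "\<omega>2 = Form (proj q a2) (proj q b2) (proj q c2) (proj q e2)"
       "\<omega>3 = Form (proj q a3) (proj q b3) (proj q c3) (proj q e3)"
    by (metis insertCI)
  have m: "x * (const (complex_of_real (- q\<^sup>2)) * y) = const (complex_of_real (- q\<^sup>2)) * (x * y)" for x y
    by (rule const_left_commute)
  show ?thesis
    unfolding w by (simp add: wedge_def proj_simps twist_proj[OF assms(1)] free_twist_mult[OF assms(1)]
      free_scalar assms(1) distrib_left distrib_right mult.assoc m add_ac del: const_simps of_real_minus of_real_power)
qed

lemma hodge_formulas:
  fixes q :: real and K L M N :: complex
  assumes "q \<noteq> 0" "f \<in> carrier (CqSL2 q)"
  shows "hodge q K L M N (wedge q (e_plus q) (func q f)) = form_scal q K (wedge q (e_minus q) (func q (star q f)))"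
    and "hodge q K L M N (wedge q (e_minus q) (func q f)) = form_scal q M (wedge q (e_plus q) (func q (star q f)))"
    and "hodge q K L M N (wedge q (wedge q (e_plus q) (e_minus q)) (func q f))
      = form_scal q (- (q powi (-2)) * L) (func q (star q f))"
    and "hodge q K L M N (func q f)
      = form_scal q N (wedge q (wedge q (e_plus q) (e_minus q)) (func q (star q f)))"
proof -
  obtain x where x: "f = proj q x" using assms(2) CqSL2_cases by metis
  show "hodge q K L M N (wedge q (e_plus q) (func q f)) = form_scal q K (wedge q (e_minus q) (func q (star q f)))"
    "hodge q K L M N (wedge q (e_minus q) (func q f)) = form_scal q M (wedge q (e_plus q) (func q (star q f)))"
    "hodge q K L M N (wedge q (wedge q (e_plus q) (e_minus q)) (func q f))
      = form_scal q (- (q powi (-2)) * L) (func q (star q f))"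
    "hodge q K L M N (func q f)
      = form_scal q N (wedge q (wedge q (e_plus q) (e_minus q)) (func q (star q f)))"
    unfolding x by (simp_all add: hodge_def wedge_def e_plus_def e_minus_def func_def form_scal_def
      proj_simps twist_proj[OF assms(1)] star_proj[OF assms(1)] del: const_simps(3-5) add: const_simps(1))
qed

lemma homotopy_formulas:
  fixes q \<alpha> \<beta> :: real and \<gamma> \<epsilon> :: complex
  assumes "q \<noteq> 0" "f \<in> sphere q" "fp \<in> graded q (-2)" "fm \<in> graded q 2"
  shows "homotopy q \<alpha> \<beta> \<gamma> \<epsilon> (func q f) = func q \<zero>\<^bsub>CqSL2 q\<^esub>"
    and "homotopy q \<alpha> \<beta> \<gamma> \<epsilon>
        (form_add q (wedge q (e_plus q) (func q fp)) (wedge q (e_minus q) (func q fm)))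
      = func q (scal q (\<alpha> * q powi (-2)) (partial_minus q fp) \<oplus>\<^bsub>CqSL2 q\<^esub> scal q (\<beta> * q\<^sup>2) (partial_plus q fm))"
    and "homotopy q \<alpha> \<beta> \<gamma> \<epsilon> (wedge q (func q f) (wedge q (e_plus q) (e_minus q)))
      = form_add q (form_scal q (\<alpha> * \<gamma> * q powi (-4)) (wedge q (e_minus q) (func q (partial_minus q f))))
          (form_scal q (- (\<beta> * \<epsilon> * q ^ 4)) (wedge q (e_plus q) (func q (partial_plus q f))))"
proof -
  obtain x y z where x: "f = proj q x" "fp = proj q y" "fm = proj q z"
    using assms(2-4) by (auto simp: sphere_def graded_def)
  note defs = homotopy_def wedge_def e_plus_def e_minus_def func_def form_scal_def form_add_def proj_simps
    twist_proj[OF assms(1)] partial_plus_proj[OF assms(1)] partial_minus_proj[OF assms(1)]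
  show "homotopy q \<alpha> \<beta> \<gamma> \<epsilon> (func q f) = func q \<zero>\<^bsub>CqSL2 q\<^esub>"
    "homotopy q \<alpha> \<beta> \<gamma> \<epsilon>
        (form_add q (wedge q (e_plus q) (func q fp)) (wedge q (e_minus q) (func q fm)))
      = func q (scal q (\<alpha> * q powi (-2)) (partial_minus q fp) \<oplus>\<^bsub>CqSL2 q\<^esub> scal q (\<beta> * q\<^sup>2) (partial_plus q fm))"
    "homotopy q \<alpha> \<beta> \<gamma> \<epsilon> (wedge q (func q f) (wedge q (e_plus q) (e_minus q)))
      = form_add q (form_scal q (\<alpha> * \<gamma> * q powi (-4)) (wedge q (e_minus q) (func q (partial_minus q f))))
          (form_scal q (- (\<beta> * \<epsilon> * q ^ 4)) (wedge q (e_plus q) (func q (partial_plus q f))))"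
    unfolding sphere_commutes_with_vol[OF assms(1,2)] unfolding x
    by (simp_all add: defs del: const_simps add: const_simps(1,2))
qed

end

theory Submission
  imports Defs
begin

text \<open>
  Both conditions are identities between forms whose coefficients lie in an algebra given by
  generators and relations. To extract scalar equations from them, they are evaluated under the
  counit, the character with \<open>a, d \<mapsto> 1\<close> and \<open>b, c \<mapsto> 0\<close>: it respects the relations and intertwines
  the involution with complex conjugation, and so no basis of the quantum group is needed to know
  that the coefficients that occur are nonzero.

  The involutivity of \<open>\<diamondsuit>\<close>, on \<open>1\<close> and on \<open>e\<^sup>+ d\<^sup>2\<close>, gives \<open>L N = q\<^sup>2\<close> and \<open>K M = 1\<close>; here the
  signs come from \<open>K\<close> and \<open>N\<close> being imaginary. The relation between \<open>\<diamondsuit> \<delta>\<close> and \<open>d \<diamondsuit>\<close> has four independent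
  parts: for each of \<open>\<partial>\<^sub>+\<close> and \<open>\<partial>\<^sub>-\<close> one in degree 1 and one in degree 2. A monomial detects a part
  if the counit does not vanish on the derivative of the monomial. Up to powers of \<open>q\<close>, the
  derivative \<open>\<partial>\<^sub>+\<close> of a monomial is the sum of the ways to replace a letter \<open>a\<close> by \<open>b\<close> or \<open>c\<close> by
  \<open>d\<close>, while \<open>\<partial>\<^sub>-\<close> replaces \<open>b\<close> by \<open>a\<close> or \<open>d\<close> by \<open>c\<close>. So only monomials with a single letter from
  \<open>{b, c}\<close> are visible: \<open>c\<close> for \<open>\<partial>\<^sub>+\<close> and \<open>b\<close> for \<open>\<partial>\<^sub>-\<close>. In degree 1 the choices
  \<open>e\<^sup>+ b d\<close> and \<open>e\<^sup>- a c\<close> give \<open>N \<alpha> = K q\<^sup>5\<close> and \<open>N \<beta> q\<^sup>3 = - M\<close>, hence \<open>\<alpha>\<close> and \<open>\<beta>\<close>. In degree 2 the choices \<open>a b\<close> and \<open>c d\<close> give equations for \<open>\<alpha> \<gamma>\<^sup>*\<close> and \<open>\<beta> \<epsilon>\<^sup>*\<close>, in which the known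
  values of \<open>\<alpha>\<close> and \<open>\<beta>\<close> leave \<open>\<gamma> = q\<^sup>2\<close> and \<open>\<epsilon> = q\<^sup>-\<^sup>4\<close>.
\<close>

section \<open>The counit\<close>

definition word_counit :: "gen list \<Rightarrow> complex" where
  "word_counit w = (if set w \<subseteq> {GA, GD} then 1 else 0)"

definition counit :: "free \<Rightarrow> complex" where
  "counit x = (\<Sum>w\<in>Poly_Mapping.keys x. Poly_Mapping.lookup x w * word_counit w)"

lemma counit_add: "counit (x + y) = counit x + counit y"
proof -
  have eq: "counit z = (\<Sum>w\<in>Poly_Mapping.keys x \<union> Poly_Mapping.keys y.
      Poly_Mapping.lookup z w * word_counit w)"
    if "Poly_Mapping.keys z \<subseteq> Poly_Mapping.keys x \<union> Poly_Mapping.keys y" for z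
    unfolding counit_def
    by (rule sum.mono_neutral_left) (use that in \<open>auto simp: in_keys_iff\<close>)
  show ?thesis
    using Poly_Mapping.keys_add[of x y]
    by (simp add: eq lookup_add distrib_right sum.distrib)
qed

lemma counit_zero [simp]: "counit 0 = 0"
  by (simp add: counit_def)

lemma counit_diff: "counit (x - y) = counit x - counit y"
  using counit_add[of "x - y" y] by simp

lemma counit_single: "counit (Poly_Mapping.single w z) = z * word_counit w"
  by (simp add: counit_def)

lemma counit_mult: "counit (x * y) = counit x * counit y"
proof (induction x rule: free_induct)
  case (single u s)
  show ?case
    by (induction y rule: free_induct)
       (simp_all add: mult_single plus_list_def counit_single counit_add word_counit_def algebra_simps)
qed (simp_all add: counit_add algebra_simps)

lemma counit_const [simp]: "counit (const z) = z"
  by (simp add: const_def counit_single word_counit_def)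

lemma counit_one [simp]: "counit 1 = 1"
  using counit_const[of 1] by simp

lemma counit_letter [simp]:
  "counit (letter GA) = 1" "counit (letter GB) = 0"
  "counit (letter GC) = 0" "counit (letter GD) = 1"
  by (simp_all add: letter_def counit_single word_counit_def)

lemmas counit_simps = counit_add counit_diff counit_mult

text \<open>On the generators this is \<open>a\<^sup>* = d\<close> together with the fact that \<open>b, c\<close> and their adjoints all
  go to \<open>0\<close>; the order of a product is immaterial for the values in the complex numbers.\<close>

lemma counit_free_star: "counit (free_star q x) = cnj (counit x)"
proof (induction x rule: free_induct)
  case (single w z)
  have "counit (gen_star q g) = word_counit [g]" for g
    by (cases g) (simp_all add: counit_mult word_counit_def del: const_simps)
  then have "counit (word_star q w) = word_counit w"
    by (induction w) (simp_all add: counit_mult word_counit_def)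
  moreover have "cnj (word_counit w) = word_counit w"
    by (simp add: word_counit_def)
  ultimately show ?case
    by (simp add: free_single counit_single counit_mult)
qed (simp_all add: counit_add)

text \<open>The only relations that do not vanish term by term are those expressing \<open>d a - a d\<close> and
  \<open>a d - 1\<close> through \<open>b c\<close>; they hold since \<open>a, d \<mapsto> 1\<close>.\<close>

lemma counit_rel_ideal: "x \<in> rel_ideal q \<Longrightarrow> counit x = 0"
  by (induction rule: rel_ideal_induct)
     (auto simp: relators_def Let_def counit_simps simp del: const_simps)

lemma counit_eq_if_proj_eq: "proj q x = proj q y \<Longrightarrow> counit x = counit y"
  using counit_rel_ideal[of "x - y" q] by (simp add: proj_eq_iff counit_diff)

section \<open>Forms with given representatives of their coefficients\<close>

definition proj_form :: "real \<Rightarrow> free \<Rightarrow> free \<Rightarrow> free \<Rightarrow> free \<Rightarrow> form" where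
  "proj_form q x0 xp xm x2 = Form (proj q x0) (proj q xp) (proj q xm) (proj q x2)"

lemmas form_defs = proj_form_def func_def e_plus_def e_minus_def wedge_def form_add_def
  form_scal_def proj_simps

lemma form_scal_proj_form:
  "form_scal q z (proj_form q x0 xp xm x2)
     = proj_form q (const z * x0) (const z * xp) (const z * xm) (const z * x2)"
  by (simp add: form_defs)

lemma hodge_proj_form:
  fixes q :: real and K L M N :: complex
  assumes "q \<noteq> 0"
  shows "hodge q K L M N (proj_form q x0 xp xm x2)
     = proj_form q (const (- (q powi (-2)) * L) * free_star q x2) (const M * free_star q xm)
         (const K * free_star q xp) (const N * free_star q x0)"
  by (simp add: hodge_def proj_form_def proj_simps star_proj[OF assms] del: const_simps)

lemma homotopy_proj_form:
  fixes q \<alpha> \<beta> :: real and \<gamma> \<epsilon> :: complex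
  assumes "q \<noteq> 0"
  shows "homotopy q \<alpha> \<beta> \<gamma> \<epsilon> (proj_form q x0 xp xm x2)
     = proj_form q
         (const (\<alpha> * q powi (-2)) * free_dm q xp + const (\<beta> * q\<^sup>2) * free_dp q xm)
         (const (- (\<beta> * \<epsilon> * q ^ 4)) * free_dp q x2)
         (const (\<alpha> * \<gamma> * q powi (-4)) * free_dm q x2) 0"
  by (simp add: homotopy_def proj_form_def proj_simps partial_plus_proj[OF assms]
      partial_minus_proj[OF assms] del: const_simps)

text \<open>The signs in the last coefficient combine the Leibniz rule, which contributes \<open>-1\<close>, with
  \<open>e\<^sup>- \<and> e\<^sup>+ = - q\<^sup>2 e\<^sup>+ \<and> e\<^sup>-\<close>.\<close>

lemma ext_d_proj_form:
  assumes "q \<noteq> 0"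
  shows "ext_d q (proj_form q x0 xp xm x2)
     = proj_form q 0 (free_dp q x0) (free_dm q x0)
         (const (q\<^sup>2) * free_dp q xm - free_dm q xp)"
  by (simp add: ext_d_def d_fun_def form_defs partial_plus_proj[OF assms]
      partial_minus_proj[OF assms] twist_proj[OF assms] algebra_simps)

lemma word_in_graded: "word_grade w = g \<Longrightarrow> proj q (word w) \<in> graded q g"
  unfolding graded_def by (rule imageI) (simp add: word_def)

lemma zero_in_graded: "proj q 0 \<in> graded q g"
  unfolding graded_def by (rule imageI) simp

lemma proj_form_in_Omega:
  assumes "q \<noteq> 0"
  shows "proj q x0 \<in> graded q 0 \<Longrightarrow> proj_form q x0 0 0 0 \<in> Omega q 0"
    and "proj q xp \<in> graded q (-2) \<Longrightarrow> proj q xm \<in> graded q 2 \<Longrightarrow> proj_form q 0 xp xm 0 \<in> Omega q 1"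
    and "proj q x2 \<in> graded q 0 \<Longrightarrow> proj_form q 0 0 0 x2 \<in> Omega q 2"
proof -
  show "proj_form q x0 0 0 0 \<in> Omega q 0" if "proj q x0 \<in> graded q 0"
    using that by (force simp: Omega_def sphere_def form_defs)
  have "proj_form q 0 xp xm 0
      = form_add q (wedge q (e_plus q) (func q (proj q xp))) (wedge q (e_minus q) (func q (proj q xm)))"
    by (simp add: form_defs twist_proj[OF assms])
  then show "proj_form q 0 xp xm 0 \<in> Omega q 1"
    if "proj q xp \<in> graded q (-2)" "proj q xm \<in> graded q 2"
    using that by (auto simp: Omega_def)
  have "proj_form q 0 0 0 x2 = wedge q (wedge q (e_plus q) (e_minus q)) (func q (proj q x2))"
    by (simp add: form_defs twist_proj[OF assms])
  then show "proj_form q 0 0 0 x2 \<in> Omega q 2" if "proj q x2 \<in> graded q 0"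
    using that by (auto simp: Omega_def sphere_def)
qed

lemma counit_eq_if_proj_form_eq:
  assumes "proj_form q x0 xp xm x2 = proj_form q y0 yp ym y2"
  shows "counit x0 = counit y0" "counit xp = counit yp" "counit xm = counit ym" "counit x2 = counit y2"
  using assms by (auto simp: proj_form_def intro: counit_eq_if_proj_eq)

section \<open>The two conditions under the counit\<close>

lemma imaginary_cnj: "Re z = 0 \<Longrightarrow> cnj z = - z"
  by (simp add: complex_eq_iff)

lemma hodge_square_counit:
  fixes q :: real and K L M N :: complex
  assumes "q \<noteq> 0" "Re K = 0" "Re N = 0"
    and sq: "\<forall>n\<le>2. \<forall>\<xi>\<in>Omega q n.
           hodge q K L M N (hodge q K L M N \<xi>) = form_scal q ((-1) ^ (n * (2 - n))) \<xi>"
  shows "L * N = complex_of_real q ^ 2" and "K * M = 1"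
proof -
  have 0: "proj_form q (word []) 0 0 0 \<in> Omega q 0"
    and 1: "proj_form q 0 (word [GD, GD]) 0 0 \<in> Omega q 1"
    by (rule proj_form_in_Omega[OF assms(1)];
        auto intro!: word_in_graded zero_in_graded simp: word_grade_def)+
  have "complex_of_real (q powi (-2)) * L * N = 1"
    using counit_eq_if_proj_form_eq(1)[OF
      sq[rule_format, OF _ 0, simplified hodge_proj_form[OF assms(1)] form_scal_proj_form]]
    by (simp add: counit_mult counit_free_star word_Nil imaginary_cnj[OF assms(3)] del: const_simps)
  then show "L * N = complex_of_real q ^ 2"
    using assms(1) by (simp add: power_int_minus field_simps)
  show "K * M = 1"
    using counit_eq_if_proj_form_eq(2)[OF
      sq[rule_format, OF _ 1, simplified hodge_proj_form[OF assms(1)] form_scal_proj_form]]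
    by (simp add: counit_mult counit_free_star word_Nil word_Cons imaginary_cnj[OF assms(2)]
        mult.commute del: const_simps)
qed

text \<open>Taking \<open>x\<close> or \<open>y\<close> to be \<open>0\<close> separates the contributions of \<open>\<partial>\<^sub>-\<close> and \<open>\<partial>\<^sub>+\<close>.\<close>

lemma hodge_homotopy_counit_degree_1:
  fixes q \<alpha> \<beta> :: real and \<gamma> \<epsilon> K L M N :: complex
  assumes "q \<noteq> 0"
    and comm: "\<forall>n\<le>2. \<forall>\<xi>\<in>Omega q n.
           form_scal q ((-1) ^ n) (hodge q K L M N (homotopy q \<alpha> \<beta> \<gamma> \<epsilon> \<xi>))
             = ext_d q (hodge q K L M N \<xi>)"
    and "proj q x \<in> graded q (-2)" "proj q y \<in> graded q 2"
  shows "- N * (\<alpha> * q powi (-2) * cnj (counit (free_dm q x)) + \<beta> * q ^ 2 * cnj (counit (free_dp q y)))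
    = q ^ 2 * counit (free_dp q (const K * free_star q x)) - counit (free_dm q (const M * free_star q y))"
proof -
  note 1 = proj_form_in_Omega(2)[OF assms(1,3,4)]
  show ?thesis
    using counit_eq_if_proj_form_eq(4)[OF
      comm[rule_format, OF _ 1, simplified hodge_proj_form[OF assms(1)] form_scal_proj_form
        homotopy_proj_form[OF assms(1)] ext_d_proj_form[OF assms(1)]]]
    by (simp add: counit_simps counit_free_star algebra_simps del: const_simps)
qed

lemma hodge_homotopy_counit_degree_2:
  fixes q \<alpha> \<beta> :: real and \<gamma> \<epsilon> K L M N :: complex
  assumes "q \<noteq> 0"
    and comm: "\<forall>n\<le>2. \<forall>\<xi>\<in>Omega q n.
           form_scal q ((-1) ^ n) (hodge q K L M N (homotopy q \<alpha> \<beta> \<gamma> \<epsilon> \<xi>))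
             = ext_d q (hodge q K L M N \<xi>)"
    and "proj q x \<in> graded q 0"
  shows "M * \<alpha> * cnj \<gamma> * q powi (-4) * cnj (counit (free_dm q x))
      = counit (free_dp q (const (- (q powi (-2)) * L) * free_star q x))"
    and "- K * \<beta> * cnj \<epsilon> * q ^ 4 * cnj (counit (free_dp q x))
      = counit (free_dm q (const (- (q powi (-2)) * L) * free_star q x))"
proof -
  note 2 = proj_form_in_Omega(3)[OF assms(1,3)]
  note eq = comm[rule_format, OF _ 2, simplified hodge_proj_form[OF assms(1)] form_scal_proj_form
        homotopy_proj_form[OF assms(1)] ext_d_proj_form[OF assms(1)]]
  show "M * \<alpha> * cnj \<gamma> * q powi (-4) * cnj (counit (free_dm q x))
      = counit (free_dp q (const (- (q powi (-2)) * L) * free_star q x))"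
    using counit_eq_if_proj_form_eq(2)[OF eq]
    by (simp add: counit_simps counit_free_star algebra_simps del: const_simps)
  show "- K * \<beta> * cnj \<epsilon> * q ^ 4 * cnj (counit (free_dp q x))
      = counit (free_dm q (const (- (q powi (-2)) * L) * free_star q x))"
    using counit_eq_if_proj_form_eq(3)[OF eq]
    by (simp add: counit_simps counit_free_star algebra_simps del: const_simps)
qed

theorem corollary10p5:
  fixes q \<alpha> \<beta> :: real and \<gamma> \<epsilon> K L M N :: complex
  assumes "q \<noteq> 0" and "\<alpha> \<noteq> 0" and "\<beta> \<noteq> 0" and "\<gamma> \<noteq> 0" and "\<epsilon> \<noteq> 0"
    and "Re K = 0" and "K \<noteq> 0" and "Re L = 0" and "L \<noteq> 0"
    and "Re M = 0" and "M \<noteq> 0" and "Re N = 0" and "N \<noteq> 0"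
    and "\<forall>n\<le>2. \<forall>\<xi>\<in>Omega q n.
           form_scal q ((-1) ^ n) (hodge q K L M N (homotopy q \<alpha> \<beta> \<gamma> \<epsilon> \<xi>))
             = ext_d q (hodge q K L M N \<xi>)"
    and "\<forall>n\<le>2. \<forall>\<xi>\<in>Omega q n.
           hodge q K L M N (hodge q K L M N \<xi>) = form_scal q ((-1) ^ (n * (2 - n))) \<xi>"
  shows "complex_of_real \<alpha> = K * L * complex_of_real q ^ 3
    \<and> complex_of_real \<beta> = - (L / K) * complex_of_real q powi (-5)
    \<and> \<gamma> = complex_of_real q ^ 2
    \<and> \<epsilon> = complex_of_real q powi (-4)"
proof -
  note q = assms(1)
  note LN = hodge_square_counit(1)[OF q assms(6,12,15)]
  note KM = hodge_square_counit(2)[OF q assms(6,12,15)]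
  note comm1 = hodge_homotopy_counit_degree_1[OF q assms(14)]
  note comm2 = hodge_homotopy_counit_degree_2[OF q assms(14)]
  have N: "N = q ^ 2 / L" and M: "M = 1 / K"
    using LN KM assms(7,9) by (simp_all add: field_simps)
  note eval = word_Cons word_Nil free_star_mult free_twist_mult[OF q] free_dp_mult[OF q]
    counit_simps power_int_minus power_numeral_reduce field_simps
  have grades: "proj q (word [GB, GD]) \<in> graded q (-2)" "proj q (word [GA, GC]) \<in> graded q 2"
    "proj q (word [GA, GB]) \<in> graded q 0" "proj q (word [GC, GD]) \<in> graded q 0"
    by (auto intro!: word_in_graded simp: word_grade_def)

  have "N * \<alpha> = K * q ^ 5"
    using comm1[OF grades(1) zero_in_graded] q
    by (simp add: eval del: const_simps)
  then have \<alpha>: "complex_of_real \<alpha> = K * L * q ^ 3"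
    using q assms(9) by (simp add: N field_simps power_numeral_reduce)

  have "- (N * \<beta> * q ^ 3) = M"
    using comm1[OF zero_in_graded grades(2)] q
    by (simp add: eval del: const_simps)
  then have \<beta>: "complex_of_real \<beta> = - (L / K) * q powi (-5)"
    using q assms(7,9)
    by (simp add: M N field_simps power_int_minus power_numeral_reduce) (metis minus_minus)

  have "M * \<alpha> * cnj \<gamma> = L * q ^ 5"
    using comm2(1)[OF grades(3)] q
    by (simp add: eval del: const_simps)
  then have "cnj \<gamma> = q ^ 2"
    using q assms(7,9) by (simp add: M \<alpha> field_simps power_numeral_reduce)
  then have \<gamma>: "\<gamma> = q ^ 2"
    by (metis complex_cnj_cnj complex_cnj_complex_of_real)

  have "- (K * \<beta> * cnj \<epsilon> * q ^ 9) = L"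
    using comm2(2)[OF grades(4)] q
    by (simp add: eval del: const_simps)
  then have "cnj \<epsilon> = q powi (-4)"
    using q assms(7,9) by (simp add: \<beta> field_simps power_int_minus power_numeral_reduce)
  then have \<epsilon>: "\<epsilon> = q powi (-4)"
    by (metis complex_cnj_cnj complex_cnj_complex_of_real)

  show ?thesis
    using \<alpha> \<beta> \<gamma> \<epsilon> by simp
qed

end
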